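(* Let $U, V, W$ be vector spaces over a field $F$, let $T_1 \colon V \to W$ and $T_2 \colon U \to V$ be linear, and let $G_1 = \operatorname{O}(T_1, \mathscr{B}_1, E_1)$ and $G_2 = \operatorname{O}(T_2, \mathscr{B}_2, E_2)$ be outer inverses of $T_1$ and $T_2$, where $\mathscr{B}_1 \leq V^*$ and $\mathscr{B}_2 \leq U^*$ are orthogonally closed subspaces, $E_1 \leq W$ and $E_2 \leq V$. If $G_2G_1$ is an outer inverse of $T_1T_2$, then $$\operatorname{O}(T_2, \mathscr{B}_2, E_2)\,\operatorname{O}(T_1, \mathscr{B}_1, E_1) = \operatorname{O}\bigl(T_1T_2,\ \mathscr{B}_2 \oplus T_2^*(\mathscr{B}_1 \cap E_2^{\perp}),\ E_1 \oplus T_1(\mathscr{B}_1^{\perp} \cap E_2)\bigr),$$ where $T_2^*$ denotes the transpose of $T_2$.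
   Context: Vector spaces are arbitrary (possibly infinite-dimensional); $V^*$ is the algebraic dual of $V$. For $V_1\leq V$, $V_1^{\perp}=\{\beta\in V^* \mid \beta(v)=0 \text{ for all } v\in V_1\}\leq V^*$; for $\mathscr{B}\leq V^*$, $\mathscr{B}^{\perp}=\{v\in V\mid \beta(v)=0\text{ for all }\beta\in\mathscr{B}\}\leq V$. A subspace $\mathscr{B}\leq V^*$ is orthogonally closed if $\mathscr{B}=\mathscr{B}^{\perp\perp}$. The transpose of a linear map $A\colon V\to W$ is $A^*\colon W^*\to V^*$, $\gamma\mapsto\gamma\circ A$. For a linear map $T\colon V\to W$, a linear map $G\colon W\to V$ is an outer inverse of $T$ if $GTG=G$; an outer inverse of $T$ is uniquely determined by its image and kernel. For an orthogonally closed $\mathscr{B}\leq V^*$ and $E\leq W$, $\operatorname{O}(T,\mathscr{B},E)$ denotes the outer inverse $G$ of $T$ with $\operatorname{Im} G=\mathscr{B}^{\perp}$ and $\operatorname{Ker} G=E$. $\oplus$ denotes a sum of subspaces that is direct. *)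

theory Defs
  imports Complex_Main "HOL-Library.Function_Algebras" "HOL-Library.Set_Algebras"
begin

(* A vector space over the field 'f is a type together with a scalar multiplication
   satisfying vector_space; its algebraic dual is a set of functions into 'f. The
   additive structure on functions is the pointwise one of Function_Algebras, and
   sums of subspaces are the set sums of Set_Algebras. *)

definition dual :: "('f::field \<Rightarrow> 'v::ab_group_add \<Rightarrow> 'v) \<Rightarrow> ('v \<Rightarrow> 'f) set" where
  "dual sV = {\<beta>. Vector_Spaces.linear sV (*) \<beta>}"

definition dual_scale :: "'f::field \<Rightarrow> ('v \<Rightarrow> 'f) \<Rightarrow> ('v \<Rightarrow> 'f)" where
  "dual_scale c \<beta> = (\<lambda>v. c * \<beta> v)"

definition annihilator ::
  "('f::field \<Rightarrow> 'v::ab_group_add \<Rightarrow> 'v) \<Rightarrow> 'v set \<Rightarrow> ('v \<Rightarrow> 'f) set" where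
  "annihilator sV S = {\<beta> \<in> dual sV. \<forall>v\<in>S. \<beta> v = 0}"

definition preannihilator :: "('v \<Rightarrow> 'f::field) set \<Rightarrow> 'v set" where
  "preannihilator B = {v. \<forall>\<beta>\<in>B. \<beta> v = 0}"

definition orthogonally_closed ::
  "('f::field \<Rightarrow> 'v::ab_group_add \<Rightarrow> 'v) \<Rightarrow> ('v \<Rightarrow> 'f) set \<Rightarrow> bool" where
  "orthogonally_closed sV B \<longleftrightarrow>
     B \<subseteq> dual sV \<and> module.subspace dual_scale B \<and>
     B = annihilator sV (preannihilator B)"

definition transpose_map :: "('v \<Rightarrow> 'w) \<Rightarrow> ('w \<Rightarrow> 'f) \<Rightarrow> ('v \<Rightarrow> 'f)" where
  "transpose_map A \<gamma> = \<gamma> \<circ> A"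

definition is_outer_inverse ::
  "('f::field \<Rightarrow> 'v::ab_group_add \<Rightarrow> 'v) \<Rightarrow> ('f \<Rightarrow> 'w::ab_group_add \<Rightarrow> 'w) \<Rightarrow>
   ('v \<Rightarrow> 'w) \<Rightarrow> ('w \<Rightarrow> 'v) \<Rightarrow> bool" where
  "is_outer_inverse sV sW T G \<longleftrightarrow> Vector_Spaces.linear sW sV G \<and> G \<circ> T \<circ> G = G"

definition is_outer_inverse_with ::
  "('f::field \<Rightarrow> 'v::ab_group_add \<Rightarrow> 'v) \<Rightarrow> ('f \<Rightarrow> 'w::ab_group_add \<Rightarrow> 'w) \<Rightarrow>
   ('v \<Rightarrow> 'w) \<Rightarrow> ('v \<Rightarrow> 'f) set \<Rightarrow> 'w set \<Rightarrow> ('w \<Rightarrow> 'v) \<Rightarrow> bool" where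
  "is_outer_inverse_with sV sW T B E G \<longleftrightarrow>
     is_outer_inverse sV sW T G \<and> range G = preannihilator B \<and> {w. G w = 0} = E"

(* O(T, B, E). Unspecified unless an outer inverse with the prescribed image and kernel
   exists; if one exists it is unique, see outer_inverse_O_eq. *)
definition outer_inverse_O ::
  "('f::field \<Rightarrow> 'v::ab_group_add \<Rightarrow> 'v) \<Rightarrow> ('f \<Rightarrow> 'w::ab_group_add \<Rightarrow> 'w) \<Rightarrow>
   ('v \<Rightarrow> 'w) \<Rightarrow> ('v \<Rightarrow> 'f) set \<Rightarrow> 'w set \<Rightarrow> ('w \<Rightarrow> 'v)" where
  "outer_inverse_O sV sW T B E = (THE G. is_outer_inverse_with sV sW T B E G)"

lemma is_outer_inverse_with_unique:
  assumes G: "is_outer_inverse_with sV sW T B E G"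
    and H: "is_outer_inverse_with sV sW T B E H"
  shows "G = H"
proof
  fix w
  interpret G: Vector_Spaces.linear sW sV G
    using G by (simp add: is_outer_inverse_with_def is_outer_inverse_def)
  interpret H: Vector_Spaces.linear sW sV H
    using H by (simp add: is_outer_inverse_with_def is_outer_inverse_def)
  have GTG: "G (T (G x)) = G x" and HTH: "H (T (H x)) = H x" for x
    using G H unfolding is_outer_inverse_with_def is_outer_inverse_def
    by (metis comp_apply)+
  have rng: "range G = range H" and ker: "G x = 0 \<longleftrightarrow> H x = 0" for x
    using G H unfolding is_outer_inverse_with_def by auto
  have "H (T (H w) - w) = 0" by (simp add: H.diff HTH)
  then have "G (T (H w) - w) = 0" by (simp add: ker)
  then have "G (T (H w)) = G w" by (simp add: G.diff)
  moreover obtain x where "H w = G x" using rng by (metis rangeE rangeI)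
  ultimately show "G w = H w" by (simp add: GTG)
qed

lemma outer_inverse_O_eq:
  "is_outer_inverse_with sV sW T B E G \<Longrightarrow> outer_inverse_O sV sW T B E = G"
  unfolding outer_inverse_O_def by (rule the_equality) (auto dest: is_outer_inverse_with_unique)

lemma vector_space_dual_scale:
  "vector_space (dual_scale :: 'f::field \<Rightarrow> ('v \<Rightarrow> 'f) \<Rightarrow> ('v \<Rightarrow> 'f))"
  by unfold_locales (auto simp: dual_scale_def plus_fun_def algebra_simps)

end

theory Submission imports Defs begin

text \<open>Write \<open>I\<^sub>1 = Im G\<^sub>1\<close> and \<open>I\<^sub>2 = Im G\<^sub>2\<close>, so that \<open>B\<^sub>i\<close> is the annihilator of \<open>I\<^sub>i\<close>. The identity
  \<open>G\<^sub>i T\<^sub>i G\<^sub>i = G\<^sub>i\<close> says that \<open>G\<^sub>i T\<^sub>i\<close> fixes \<open>I\<^sub>i\<close> pointwise and that \<open>w - T\<^sub>i G\<^sub>i w\<close> lies in \<open>E\<^sub>i\<close>.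
  The latter splits \<open>w\<close> with \<open>G\<^sub>1 w \<in> E\<^sub>2\<close> into \<open>(w - T\<^sub>1 G\<^sub>1 w) + T\<^sub>1 G\<^sub>1 w\<close>, which gives the kernel of \<open>G\<^sub>2 G\<^sub>1\<close>.
  A functional \<open>\<beta>\<close> vanishing on \<open>G\<^sub>2(I\<^sub>1)\<close> splits as
  \<open>(\<beta> - \<beta> G\<^sub>2 T\<^sub>2) + \<beta> G\<^sub>2 T\<^sub>2\<close>, so the sum of functionals is the annihilator of \<open>G\<^sub>2(I\<^sub>1)\<close>. Hence it is
  orthogonally closed, and its preannihilator is \<open>G\<^sub>2(I\<^sub>1) = Im G\<^sub>2 G\<^sub>1\<close>.\<close>

lemma vector_space_mult: "vector_space ((*) :: 'f::field \<Rightarrow> 'f \<Rightarrow> 'f)"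
  by unfold_locales (auto simp: algebra_simps)

lemma
  assumes "\<beta> \<in> dual sV"
  shows dual_diff: "\<beta> (x - y) = \<beta> x - \<beta> y"
    and dual_zero: "\<beta> 0 = 0"
proof -
  interpret Vector_Spaces.linear sV "(*)" \<beta>
    using assms by (simp add: dual_def)
  show "\<beta> (x - y) = \<beta> x - \<beta> y" "\<beta> 0 = 0"
    by (rule diff, rule zero)
qed

lemma dual_iff:
  assumes "vector_space sV"
  shows "\<beta> \<in> dual sV \<longleftrightarrow>
    (\<forall>x y. \<beta> (x + y) = \<beta> x + \<beta> y) \<and> (\<forall>c x. \<beta> (sV c x) = c * \<beta> x)"
  unfolding dual_def by (auto simp: Vector_Spaces.linear_iff assms vector_space_mult)

lemma subspace_annihilator:
  assumes "vector_space sV"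
  shows "module.subspace dual_scale (annihilator sV S)"
proof -
  interpret D: vector_space "dual_scale :: 'a \<Rightarrow> ('b \<Rightarrow> 'a) \<Rightarrow> ('b \<Rightarrow> 'a)"
    by (rule vector_space_dual_scale)
  show ?thesis
    unfolding D.subspace_def annihilator_def
    using assms by (auto simp: dual_iff dual_scale_def algebra_simps)
qed

text \<open>A vector \<open>v\<close> outside \<open>S\<close> is separated from \<open>S\<close>:
  adjoining \<open>v\<close> to a basis of \<open>S\<close> keeps it independent, so some functional
  is 1 at \<open>v\<close> and 0 on \<open>S\<close>. This works in any dimension.\<close>

lemma preannihilator_annihilator:
  assumes "vector_space sV" and S: "module.subspace sV S"
  shows "preannihilator (annihilator sV S) = S"
proof
  interpret vector_space_pair sV "(*) :: 'a \<Rightarrow> 'a \<Rightarrow> 'a"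
    using assms(1) vector_space_mult by (simp add: vector_space_pair_def)
  show "S \<subseteq> preannihilator (annihilator sV S)"
    by (auto simp: annihilator_def preannihilator_def)
  show "preannihilator (annihilator sV S) \<subseteq> S"
  proof (rule subsetI, rule ccontr)
    fix v assume v: "v \<in> preannihilator (annihilator sV S)" and "v \<notin> S"
    obtain A where A: "A \<subseteq> S" "vs1.independent A" "S \<subseteq> vs1.span A"
      using vs1.maximal_independent_subset by blast
    have "vs1.span A = S"
      using A S by (simp add: vs1.span_subspace)
    with \<open>v \<notin> S\<close> A(2) have "vs1.independent (insert v A)"
      by (simp add: vs1.independent_insertI)
    from linear_independent_extend[OF this, of "\<lambda>x. if x = v then 1 else 0"]
    obtain g where g: "Vector_Spaces.linear sV (*) g"
      and gi: "\<forall>x\<in>insert v A. g x = (if x = v then 1 else 0)"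
      by blast
    interpret g: Vector_Spaces.linear sV "(*)" g by (rule g)
    have "\<forall>x\<in>A. g x = 0"
      using gi A(1) \<open>v \<notin> S\<close> by auto
    then have "\<forall>x\<in>S. g x = 0"
      using \<open>vs1.span A = S\<close> g.eq_0_on_span by blast
    then have "g \<in> annihilator sV S"
      by (simp add: annihilator_def dual_def g)
    with v have "g v = 0"
      by (simp add: preannihilator_def)
    with gi show False by simp
  qed
qed

theorem theorem15:
  fixes sU :: "'f::field \<Rightarrow> 'u::ab_group_add \<Rightarrow> 'u"
    and sV :: "'f \<Rightarrow> 'v::ab_group_add \<Rightarrow> 'v"
    and sW :: "'f \<Rightarrow> 'w::ab_group_add \<Rightarrow> 'w"
    and T1 :: "'v \<Rightarrow> 'w" and T2 :: "'u \<Rightarrow> 'v"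
    and G1 :: "'w \<Rightarrow> 'v" and G2 :: "'v \<Rightarrow> 'u"
    and B1 :: "('v \<Rightarrow> 'f) set" and B2 :: "('u \<Rightarrow> 'f) set"
    and B :: "('u \<Rightarrow> 'f) set" and E :: "'w set"
    and E1 :: "'w set" and E2 :: "'v set"
  assumes "vector_space sU" and "vector_space sV" and "vector_space sW"
    and "Vector_Spaces.linear sV sW T1" and "Vector_Spaces.linear sU sV T2"
    and "orthogonally_closed sV B1" and "orthogonally_closed sU B2"
    and "module.subspace sW E1" and "module.subspace sV E2"
    and "is_outer_inverse_with sV sW T1 B1 E1 G1"
    and "is_outer_inverse_with sU sV T2 B2 E2 G2"
    and "is_outer_inverse sU sW (T1 \<circ> T2) (G2 \<circ> G1)"
    and "B = B2 + transpose_map T2 ` (B1 \<inter> annihilator sV E2)"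
    and "E = E1 + T1 ` (preannihilator B1 \<inter> E2)"
  shows "B2 \<inter> transpose_map T2 ` (B1 \<inter> annihilator sV E2) = {0}
    \<and> E1 \<inter> T1 ` (preannihilator B1 \<inter> E2) = {0}
    \<and> orthogonally_closed sU B
    \<and> is_outer_inverse_with sU sW (T1 \<circ> T2) B E (G2 \<circ> G1)
    \<and> outer_inverse_O sU sV T2 B2 E2 \<circ> outer_inverse_O sV sW T1 B1 E1
        = outer_inverse_O sU sW (T1 \<circ> T2) B E"
proof -
  interpret VW: Vector_Spaces.linear sV sW T1 by fact
  interpret UV: Vector_Spaces.linear sU sV T2 by fact
  interpret G1: Vector_Spaces.linear sW sV G1
    using assms(10) by (simp add: is_outer_inverse_with_def is_outer_inverse_def)
  interpret G2: Vector_Spaces.linear sV sU G2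
    using assms(11) by (simp add: is_outer_inverse_with_def is_outer_inverse_def)
  have G1TG1: "G1 (T1 (G1 x)) = G1 x" for x
    using assms(10) unfolding is_outer_inverse_with_def is_outer_inverse_def by (metis comp_apply)
  have G2TG2: "G2 (T2 (G2 x)) = G2 x" for x
    using assms(11) unfolding is_outer_inverse_with_def is_outer_inverse_def by (metis comp_apply)
  have rng: "preannihilator B1 = range G1" "preannihilator B2 = range G2"
    and ker: "x \<in> E1 \<longleftrightarrow> G1 x = 0" "y \<in> E2 \<longleftrightarrow> G2 y = 0" for x y
    using assms(10,11) unfolding is_outer_inverse_with_def by auto
  \<comment> \<open>Orthogonal closedness enters here: membership in \<open>B1\<close> or
    \<open>B2\<close> becomes vanishing on the image of \<open>G1\<close> or
    \<open>G2\<close>.\<close>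
  have B1: "B1 = annihilator sV (range G1)" and B2: "B2 = annihilator sU (range G2)"
    using assms(6,7) unfolding orthogonally_closed_def rng by auto
  let ?C = "transpose_map T2 ` (B1 \<inter> annihilator sV E2)"
  have compT2: "\<gamma> \<circ> T2 \<in> dual sU" if "\<gamma> \<in> dual sV" for \<gamma>
    using that by (simp add: dual_iff assms(1,2) UV.add UV.scale)
  have compG2: "\<beta> \<circ> G2 \<in> dual sV" if "\<beta> \<in> dual sU" for \<beta>
    using that by (simp add: dual_iff assms(1,2) G2.add G2.scale)
  have zero: "0 \<in> dual sU" "0 \<in> dual sV"
    by (auto simp: dual_iff assms(1,2))
  have zB2: "0 \<in> B2" and zC: "0 \<in> ?C"
  proof -
    show "0 \<in> B2" by (simp add: B2 annihilator_def zero)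
    have "0 \<in> B1 \<inter> annihilator sV E2" by (simp add: B1 annihilator_def zero)
    moreover have "transpose_map T2 0 = (0 :: 'u \<Rightarrow> 'f)"
      by (auto simp: transpose_map_def)
    ultimately show "0 \<in> ?C" by (metis imageI)
  qed

  have direct_B: "B2 \<inter> ?C = {0}"
  proof -
    have "\<beta> = 0" if "\<beta> \<in> B2" "\<beta> \<in> ?C" for \<beta>
    proof -
      obtain \<gamma> where \<gamma>: "\<gamma> \<in> annihilator sV E2" "\<beta> = \<gamma> \<circ> T2"
        using \<open>\<beta> \<in> ?C\<close> by (auto simp: transpose_map_def)
      \<comment> \<open>Modulo \<open>E2\<close>, where \<open>\<gamma>\<close> vanishes,
        \<open>v\<close> equals \<open>T2 (G2 v)\<close>; there \<open>\<gamma>\<close> takes the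
        value \<open>\<beta> (G2 v)\<close>.\<close>
      have "\<gamma> v = 0" for v
      proof -
        have "v - T2 (G2 v) \<in> E2" by (simp add: ker G2.diff G2TG2)
        with \<gamma>(1) have "\<gamma> v = \<gamma> (T2 (G2 v))"
          by (auto simp: annihilator_def dual_diff)
        also have "\<dots> = 0"
          using \<open>\<beta> \<in> B2\<close> \<gamma>(2) by (auto simp: B2 annihilator_def)
        finally show ?thesis .
      qed
      then show "\<beta> = 0" by (auto simp: \<gamma>(2))
    qed
    with zB2 zC show ?thesis by blast
  qed

  have direct_E: "E1 \<inter> T1 ` (preannihilator B1 \<inter> E2) = {0}"
  proof -
    have "0 \<in> T1 ` (range G1 \<inter> E2)"
      using VW.zero G1.zero G2.zero by (metis IntI imageI ker(2) rangeI)
    \<comment> \<open>Applying \<open>G1\<close> to \<open>T1 (G1 x)\<close> returns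
      \<open>G1 x\<close>, which is 0 once \<open>T1 (G1 x)\<close> lies in the kernel
      \<open>E1\<close>.\<close>
    moreover have "T1 (G1 x) = 0" if "T1 (G1 x) \<in> E1" for x
      using that by (simp add: ker G1TG1 VW.zero)
    ultimately show ?thesis by (auto simp: rng ker G1.zero)
  qed

  have B_eq: "B = annihilator sU (range (G2 \<circ> G1))"
  proof
    have "\<beta> + (\<gamma> \<circ> T2) \<in> annihilator sU (range (G2 \<circ> G1))"
      if \<beta>: "\<beta> \<in> B2" and \<gamma>: "\<gamma> \<in> B1" "\<gamma> \<in> annihilator sV E2" for \<beta> \<gamma>
    proof -
      \<comment> \<open>The argument differs from \<open>G1 w\<close> by an element of
        \<open>E2\<close>, and \<open>\<gamma>\<close> vanishes on both \<open>E2\<close> and the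
        image of \<open>G1\<close>.\<close>
      have "\<gamma> (T2 (G2 (G1 w))) = 0" for w
      proof -
        have "G1 w - T2 (G2 (G1 w)) \<in> E2" by (simp add: ker G2.diff G2TG2)
        then have "\<gamma> (T2 (G2 (G1 w))) = \<gamma> (G1 w)"
          using \<gamma>(2) by (auto simp: annihilator_def dual_diff)
        then show ?thesis using \<gamma>(1) by (auto simp: B1 annihilator_def)
      qed
      moreover have "\<beta> + (\<gamma> \<circ> T2) \<in> dual sU"
        using \<beta> compT2[of \<gamma>] \<gamma> assms(1)
        by (simp add: B2 annihilator_def dual_iff algebra_simps)
      ultimately show ?thesis using \<beta> by (auto simp: B2 annihilator_def)
    qed
    then show "B \<subseteq> annihilator sU (range (G2 \<circ> G1))"
      unfolding assms(13) set_plus_def transpose_map_def by blast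
    show "annihilator sU (range (G2 \<circ> G1)) \<subseteq> B"
    proof
      fix \<beta> assume \<beta>: "\<beta> \<in> annihilator sU (range (G2 \<circ> G1))"
      then have d: "\<beta> \<in> dual sU" by (simp add: annihilator_def)
      \<comment> \<open>This functional vanishes on \<open>E2\<close>, the kernel of
        \<open>G2\<close>, and on the image of \<open>G1\<close> by the choice of
        \<open>\<beta>\<close>. Composed with \<open>T2\<close> it agrees with
        \<open>\<beta>\<close> on the image of \<open>G2\<close>, so the difference lies in
        \<open>B2\<close>.\<close>
      let ?\<gamma> = "\<beta> \<circ> G2"
      have "?\<gamma> \<in> B1 \<inter> annihilator sV E2"
        using \<beta> compG2[OF d] by (auto simp: B1 annihilator_def ker dual_zero[OF d])
      moreover have "\<beta> - (?\<gamma> \<circ> T2) \<in> B2"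
        using d compT2[OF compG2[OF d]] assms(1)
        by (auto simp: B2 annihilator_def dual_iff G2TG2 algebra_simps)
      moreover have "\<beta> = (\<beta> - (?\<gamma> \<circ> T2)) + transpose_map T2 ?\<gamma>"
        by (simp add: transpose_map_def)
      ultimately show "\<beta> \<in> B"
        unfolding assms(13) set_plus_def by blast
    qed
  qed

  have subU: "module.subspace sU (range (G2 \<circ> G1))"
    unfolding image_comp[symmetric]
    by (intro G2.subspace_image G1.subspace_image VW.vs2.subspace_UNIV)
  have rngB: "preannihilator B = range (G2 \<circ> G1)"
    unfolding B_eq by (rule preannihilator_annihilator[OF assms(1) subU])
  \<comment> \<open>The preannihilator is rewritten while \<open>B\<close> is still folded; what
    remains of the closure condition is then \<open>B_eq\<close>.\<close>
  have closed: "orthogonally_closed sU B"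
    unfolding orthogonally_closed_def rngB
    unfolding B_eq by (auto simp: subspace_annihilator[OF assms(1)]) (simp add: annihilator_def)

  have kerE: "{w. (G2 \<circ> G1) w = 0} = E"
  proof
    \<comment> \<open>\<open>G1\<close> kills the summand \<open>E1\<close> and carries
      \<open>T1 (G1 x)\<close> back to \<open>G1 x\<close>, which \<open>G2\<close> kills when it
      lies in \<open>E2\<close>.\<close>
    show "E \<subseteq> {w. (G2 \<circ> G1) w = 0}"
      by (auto simp: assms(14) set_plus_def rng ker G1.add G1TG1)
    show "{w. (G2 \<circ> G1) w = 0} \<subseteq> E"
    proof
      fix w assume "w \<in> {w. (G2 \<circ> G1) w = 0}"
      then have "T1 (G1 w) \<in> T1 ` (preannihilator B1 \<inter> E2)"
        by (auto simp: rng ker)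
      moreover have "w - T1 (G1 w) \<in> E1" by (simp add: ker G1.diff G1TG1)
      moreover have "w = (w - T1 (G1 w)) + T1 (G1 w)" by simp
      ultimately show "w \<in> E" unfolding assms(14) set_plus_def by blast
    qed
  qed
  have outer: "is_outer_inverse_with sU sW (T1 \<circ> T2) B E (G2 \<circ> G1)"
    using assms(12) rngB kerE by (simp add: is_outer_inverse_with_def)
  \<comment> \<open>Uniqueness of outer inverses with given image and kernel identifies each
    \<open>outer_inverse_O\<close> term with its explicit map, so both sides become
    \<open>G2 \<circ> G1\<close>.\<close>
  from direct_B direct_E closed outer show ?thesis
    by (simp add: outer_inverse_O_eq[OF outer] outer_inverse_O_eq[OF assms(10)]
        outer_inverse_O_eq[OF assms(11)])
qed

end
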